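(* Let $m$ be a positive integer, let $n\in\{2m,2m+1\}$, and let $F(x)=x^{2^{m+1}-1}$ be the power mapping on $\mathbb{F}_{2^n}$. For $(a,c,b)\in\mathbb{F}_{2^n}^3$ with $a\neq 0$ put $t=\frac{c}{a^{2^{m+1}-1}}$. (i) If $n=2m+1$, then $$\mathrm{FBDT}_F(a,c,b)=\begin{cases}2^n,&\text{if }(a,c,b)\in I_{2^n};\\ 2,&\text{if }(a,c,b)\in I_2;\\ 0,&\text{if }(a,c,b)\in I_0^{(1)}\cup I_0^{(2)}\cup I_0^{(3)},\end{cases}$$ where (with the convention $\frac{1}{0}=0$ when $t=0$) \begin{align*} I_{2^n}&=\{(a,c,b)\in\mathbb{F}_{2^n}^3: a=c=0\},\\ I_2&=\{(a,c,b)\in\mathbb{F}_{2^n}^3: a\neq 0,\ b\in\{0,a\}\text{ and }\mathrm{Tr}_1^n\left(\tfrac{1}{t^{2^m+1}}\right)=1\},\\ I_0^{(1)}&=\{(a,c,b)\in\mathbb{F}_{2^n}^3: a=0\text{ and }c\neq 0\},\\ I_0^{(2)}&=\{(a,c,b)\in\mathbb{F}_{2^n}^3: a\neq 0,\ b\in\{0,a\}\text{ and }\mathrm{Tr}_1^n\left(\tfrac{1}{t^{2^m+1}}\right)=0\},\\ I_0^{(3)}&=\{(a,c,b)\in\mathbb{F}_{2^n}^3: ab(a+b)\neq 0\}. \end{align*} (ii) If $n=2m$, then $$\mathrm{FBDT}_F(a,c,b)=\begin{cases}2^n,&\text{if }(a,c,b)\in I_{2^n};\\ 2^m,&\text{if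 }(a,c,b)\in I_{2^m}^{(1)}\cup I_{2^m}^{(2)};\\ 2,&\text{if }(a,c,b)\in I_2^{(1)}\cup I_2^{(2)};\\ 0,&\text{if }(a,c,b)\in I_0^{(1)}\cup I_0^{(2)}\cup I_0^{(3)}\cup I_0^{(4)}\cup I_0^{(5)}\cup I_0^{(6)},\end{cases}$$ where \begin{align*} I_{2^n}&=\{(a,c,b)\in\mathbb{F}_{2^n}^3: a=c=0\},\\ I_{2^m}^{(1)}&=\{(a,c,b)\in\mathbb{F}_{2^n}^3: a\neq 0,\ c\neq 0,\ b\in\{0,a\}\text{ and }t=1\},\\ I_{2^m}^{(2)}&=\{(a,c,b)\in\mathbb{F}_{2^n}^3: a\neq 0,\ c\neq 0,\ b\notin\{0,a\},\ t=1\text{ and }\tfrac{a}{b}\in\mathbb{F}_{2^m}\setminus\{0,1\}\},\\ I_2^{(1)}&=\{(a,c,b)\in\mathbb{F}_{2^n}^3: a\neq 0,\ c\neq 0,\ b\in\{0,a\},\ t^{2^m+1}\neq 1\text{ and }\mathrm{Tr}_1^m\left(\tfrac{t^{2^m}+t+1}{t^{2^{m+1}+2}+1}\right)=1\},\\ I_2^{(2)}&=\{(a,c,b)\in\mathbb{F}_{2^n}^3: a\neq 0,\ c=0,\ b\in\{0,a\}\text{ and }m\text{ is odd}\},\\ I_0^{(1)}&=\{(a,c,b)\in\mathbb{F}_{2^n}^3: a=0\text{ and }c\neq 0\},\\ I_0^{(2)}&=\{(a,c,b)\in\mathbb{F}_{2^n}^3: a\neq 0,\ c=0,\ b\in\{0,a\}\text{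 and }m\text{ is even}\},\\ I_0^{(3)}&=\{(a,c,b)\in\mathbb{F}_{2^n}^3: a\neq 0,\ c\neq 0,\ b\in\{0,a\},\ t^{2^m+1}\neq 1\text{ and }\mathrm{Tr}_1^m\left(\tfrac{t^{2^m}+t+1}{t^{2^{m+1}+2}+1}\right)=0\},\\ I_0^{(4)}&=\{(a,c,b)\in\mathbb{F}_{2^n}^3: a\neq 0,\ c\neq 0,\ b\in\{0,a\},\ t\neq 1\text{ and }t^{2^m+1}=1\},\\ I_0^{(5)}&=\{(a,c,b)\in\mathbb{F}_{2^n}^3: a\neq 0,\ c\neq 0,\ b\notin\{0,a\},\ t\neq 1\text{ and }\tfrac{a}{b}\in\mathbb{F}_{2^m}\setminus\{0,1\}\},\\ I_0^{(6)}&=\{(a,c,b)\in\mathbb{F}_{2^n}^3: a\neq 0,\ c\neq 0,\ b\notin\{0,a\}\text{ and }\tfrac{a}{b}\in\mathbb{F}_{2^n}\setminus\mathbb{F}_{2^m}\}. \end{align*}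
   Context: $\mathbb{F}_{2^n}$ is the finite field with $2^n$ elements. For a positive integer $k$, $\mathrm{Tr}_1^k(x)=\sum_{i=0}^{k-1}x^{2^i}$ is the absolute trace from $\mathbb{F}_{2^k}$ to $\mathbb{F}_2$. When $n=2m$, $\mathbb{F}_{2^m}$ is regarded as the subfield of $\mathbb{F}_{2^n}$ of order $2^m$, and the arguments to which $\mathrm{Tr}_1^m$ is applied lie in this subfield. For a mapping $F:\mathbb{F}_{2^n}\to\mathbb{F}_{2^n}$ and $(a,c,b)\in\mathbb{F}_{2^n}^3$, the Feistel Boomerang Difference Table (FBDT) entry is $$\mathrm{FBDT}_F(a,c,b)=|\{x\in\mathbb{F}_{2^n}: F(x)+F(x+a)+F(x+b)+F(x+a+b)=0,\ F(x)+F(x+a)=c\}|.$$ *)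

theory Defs
  imports "HOL-Computational_Algebra.Computational_Algebra" "HOL-Library.Cardinality"
begin

text \<open>
  The field with \<open>2^n\<close> elements is any type of class \<^class>\<open>finite_field\<close> whose universe has
  \<open>2^n\<close> elements. Division is total with \<open>x / 0 = 0\<close>, which agrees with the convention
  \<open>1/0 = 0\<close> used below.
\<close>

definition FBDT :: "('a::finite_field \<Rightarrow> 'a) \<Rightarrow> 'a \<Rightarrow> 'a \<Rightarrow> 'a \<Rightarrow> nat" where
  "FBDT F a c b =
     card {x. F x + F (x + a) + F (x + b) + F (x + a + b) = 0 \<and> F x + F (x + a) = c}"

text \<open>
  On the subfield of order \<open>2^k\<close> this is the absolute trace; its values in the two-element field
  are the elements 0 and 1 of the ambient type.
\<close>
definition Tr :: "nat \<Rightarrow> 'a::finite_field \<Rightarrow> 'a" where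
  "Tr k x = (\<Sum>i<k. x ^ (2 ^ i))"

definition is_subfield :: "'a::field set \<Rightarrow> bool" where
  "is_subfield K \<longleftrightarrow> 0 \<in> K \<and> 1 \<in> K \<and>
     (\<forall>x\<in>K. \<forall>y\<in>K. x + y \<in> K \<and> x * y \<in> K) \<and> (\<forall>x\<in>K. - x \<in> K \<and> inverse x \<in> K)"

text \<open>Well defined in the situation of interest by \<open>ex1_subfield_of_order\<close> below.\<close>
definition subfield_of_order :: "nat \<Rightarrow> 'a::finite_field set" where
  "subfield_of_order q = (THE K. is_subfield K \<and> card K = q)"

definition pow_F :: "nat \<Rightarrow> 'a::finite_field \<Rightarrow> 'a" where
  "pow_F m x = x ^ (2 ^ (m + 1) - 1)"

definition t_of :: "nat \<Rightarrow> 'a::finite_field \<Rightarrow> 'a \<Rightarrow> 'a" where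
  "t_of m a c = c / a ^ (2 ^ (m + 1) - 1)"

text \<open>
  Triples are in the order \<open>(a, c, b)\<close>. The prefixes \<open>odd\<close> and \<open>even\<close> stand for
  \<open>n = 2m + 1\<close> and \<open>n = 2m\<close>.
\<close>

definition I_full :: "('a::finite_field \<times> 'a \<times> 'a) set" where
  "I_full = {(a, c, b). a = 0 \<and> c = 0}"

definition odd_I_2 :: "nat \<Rightarrow> ('a::finite_field \<times> 'a \<times> 'a) set" where
  "odd_I_2 m = {(a, c, b). a \<noteq> 0 \<and> b \<in> {0, a} \<and>
     Tr (2 * m + 1) (1 / t_of m a c ^ (2 ^ m + 1)) = 1}"

definition odd_I_0_1 :: "('a::finite_field \<times> 'a \<times> 'a) set" where
  "odd_I_0_1 = {(a, c, b). a = 0 \<and> c \<noteq> 0}"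

definition odd_I_0_2 :: "nat \<Rightarrow> ('a::finite_field \<times> 'a \<times> 'a) set" where
  "odd_I_0_2 m = {(a, c, b). a \<noteq> 0 \<and> b \<in> {0, a} \<and>
     Tr (2 * m + 1) (1 / t_of m a c ^ (2 ^ m + 1)) = 0}"

definition odd_I_0_3 :: "('a::finite_field \<times> 'a \<times> 'a) set" where
  "odd_I_0_3 = {(a, c, b). a * b * (a + b) \<noteq> 0}"

definition even_I_2m_1 :: "nat \<Rightarrow> ('a::finite_field \<times> 'a \<times> 'a) set" where
  "even_I_2m_1 m = {(a, c, b). a \<noteq> 0 \<and> c \<noteq> 0 \<and> b \<in> {0, a} \<and> t_of m a c = 1}"

definition even_I_2m_2 :: "nat \<Rightarrow> ('a::finite_field \<times> 'a \<times> 'a) set" where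
  "even_I_2m_2 m = {(a, c, b). a \<noteq> 0 \<and> c \<noteq> 0 \<and> b \<notin> {0, a} \<and> t_of m a c = 1 \<and>
     a / b \<in> subfield_of_order (2 ^ m) - {0, 1}}"

definition even_I_2_1 :: "nat \<Rightarrow> ('a::finite_field \<times> 'a \<times> 'a) set" where
  "even_I_2_1 m = {(a, c, b). a \<noteq> 0 \<and> c \<noteq> 0 \<and> b \<in> {0, a} \<and>
     t_of m a c ^ (2 ^ m + 1) \<noteq> 1 \<and>
     Tr m ((t_of m a c ^ (2 ^ m) + t_of m a c + 1) / (t_of m a c ^ (2 ^ (m + 1) + 2) + 1)) = 1}"

definition even_I_2_2 :: "nat \<Rightarrow> ('a::finite_field \<times> 'a \<times> 'a) set" where
  "even_I_2_2 m = {(a, c, b). a \<noteq> 0 \<and> c = 0 \<and> b \<in> {0, a} \<and> odd m}"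

definition even_I_0_1 :: "('a::finite_field \<times> 'a \<times> 'a) set" where
  "even_I_0_1 = {(a, c, b). a = 0 \<and> c \<noteq> 0}"

definition even_I_0_2 :: "nat \<Rightarrow> ('a::finite_field \<times> 'a \<times> 'a) set" where
  "even_I_0_2 m = {(a, c, b). a \<noteq> 0 \<and> c = 0 \<and> b \<in> {0, a} \<and> even m}"

definition even_I_0_3 :: "nat \<Rightarrow> ('a::finite_field \<times> 'a \<times> 'a) set" where
  "even_I_0_3 m = {(a, c, b). a \<noteq> 0 \<and> c \<noteq> 0 \<and> b \<in> {0, a} \<and>
     t_of m a c ^ (2 ^ m + 1) \<noteq> 1 \<and>
     Tr m ((t_of m a c ^ (2 ^ m) + t_of m a c + 1) / (t_of m a c ^ (2 ^ (m + 1) + 2) + 1)) = 0}"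

definition even_I_0_4 :: "nat \<Rightarrow> ('a::finite_field \<times> 'a \<times> 'a) set" where
  "even_I_0_4 m = {(a, c, b). a \<noteq> 0 \<and> c \<noteq> 0 \<and> b \<in> {0, a} \<and>
     t_of m a c \<noteq> 1 \<and> t_of m a c ^ (2 ^ m + 1) = 1}"

definition even_I_0_5 :: "nat \<Rightarrow> ('a::finite_field \<times> 'a \<times> 'a) set" where
  "even_I_0_5 m = {(a, c, b). a \<noteq> 0 \<and> c \<noteq> 0 \<and> b \<notin> {0, a} \<and> t_of m a c \<noteq> 1 \<and>
     a / b \<in> subfield_of_order (2 ^ m) - {0, 1}}"

definition even_I_0_6 :: "nat \<Rightarrow> ('a::finite_field \<times> 'a \<times> 'a) set" where
  "even_I_0_6 m = {(a, c, b). a \<noteq> 0 \<and> c \<noteq> 0 \<and> b \<notin> {0, a} \<and>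
     a / b \<notin> subfield_of_order (2 ^ m)}"

lemma CHAR_eq_2:
  assumes "CARD('a::finite_field) = 2 ^ n"
  shows "CHAR('a) = 2"
proof -
  have "(\<Sum>x\<in>UNIV. x + 1) = (\<Sum>x\<in>UNIV. x :: 'a)"
    by (rule sum.reindex_bij_witness[of _ "\<lambda>x. x - 1" "\<lambda>x. x + 1"]) auto
  hence "(of_nat CARD('a) :: 'a) = 0"
    by (simp add: sum.distrib)
  hence "CHAR('a) dvd 2 ^ n"
    using assms of_nat_eq_0_iff_char_dvd by metis
  thus ?thesis
    using prime_dvd_power[of "CHAR('a)" 2 n] primes_dvd_imp_eq[of "CHAR('a)" 2] by auto
qed

lemma subfield_power_card:
  fixes K :: "'a::finite_field set"
  assumes K: "is_subfield K" and x: "x \<in> K"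
  shows "x ^ card K = x"
proof (cases "x = 0")
  case True
  have "card K > 0"
    using x by (auto simp: card_gt_0_iff)
  thus ?thesis
    using True by simp
next
  case False
  have div: "y / x \<in> K" if "y \<in> K" for y
    using K x that by (auto simp: is_subfield_def divide_inverse)
  have "(\<Prod>y\<in>K-{0}. x * y) = (\<Prod>y\<in>K-{0}. y)"
    by (rule prod.reindex_bij_witness[of _ "\<lambda>y. y / x" "\<lambda>y. x * y"])
       (use False K x div in \<open>auto simp: is_subfield_def\<close>)
  hence "x ^ (card K - 1) * \<Prod>(K-{0}) = \<Prod>(K-{0})"
    using K by (simp add: prod.distrib is_subfield_def)
  hence "x ^ (card K - 1) = 1"
    by simp
  moreover have "card K > 0"
    using x by (auto simp: card_gt_0_iff)
  hence "card K = Suc (card K - 1)"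
    by simp
  ultimately show ?thesis
    by (metis power_Suc mult.right_neutral)
qed

lemma ex1_subfield_of_order:
  assumes m: "m > 0" and card: "CARD('a::finite_field) = 2 ^ (2 * m)"
  shows "\<exists>!K :: 'a set. is_subfield K \<and> card K = 2 ^ m"
proof -
  define q :: nat where "q = 2 ^ m"
  define K where "K = {x :: 'a. x ^ q = x}"
  have q: "q > 1" and qq: "CARD('a) = q * q"
    using m card one_less_power[of "2::nat" m] unfolding q_def
    by (simp_all add: mult_2 power_add)
  have char: "CHAR('a) = 2"
    by (rule CHAR_eq_2[OF card])
  have add: "(x + y) ^ q = x ^ q + y ^ q" for x y :: 'a
    by (rule freshmans_dream'[where n = m]) (auto simp: char q_def)
  have "(2 :: 'a) = 0"
    using of_nat_CHAR[where ?'a = 'a] by (simp add: char)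
  hence dbl: "x + x = 0" for x :: 'a
    by (metis mult_2 mult_zero_left)
  hence neg: "- x = x" for x :: 'a
    by (metis minus_unique)
  have bound: "card {x. x ^ q = x + c} \<le> q" for c :: 'a
  proof -
    define p where "p = monom 1 q - [:c, 1:]"
    have p: "degree p = q" "p \<noteq> 0"
    proof -
      have "degree [:c, 1:] < degree (monom (1::'a) q)"
        using q by (simp add: degree_monom_eq)
      thus *: "degree p = q"
        unfolding p_def by (metis degree_add_eq_left degree_minus degree_monom_eq
            diff_conv_add_uminus one_neq_zero)
      show "p \<noteq> 0"
        using * q by auto
    qed
    have "{x. x ^ q = x + c} = {x. poly p x = 0}"
      by (auto simp: p_def poly_monom algebra_simps)
    thus ?thesis
      using card_poly_roots_bound[of p] p by simp
  qed
  have sub: "is_subfield K"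
    using q by (auto simp: is_subfield_def K_def add neg power_mult_distrib power_inverse)
  have le: "card K \<le> q"
    using bound[of 0] by (simp add: K_def)
  have "(x ^ q + x) ^ q = x ^ q + x" for x :: 'a
    using finite_field_power_card_eq_same[of x]
    by (simp add: add qq power_mult add.commute)
  hence "(UNIV :: 'a set) = (\<Union>c\<in>K. {x. x ^ q = x + c})"
  proof -
    assume *: "\<And>x :: 'a. (x ^ q + x) ^ q = x ^ q + x"
    have "x \<in> (\<Union>c\<in>K. {x. x ^ q = x + c})" for x :: 'a
    proof -
      have "x ^ q = x + (x ^ q + x)"
        using dbl[of x] by (metis add.assoc add.commute add_0)
      thus ?thesis
        using *[of x] by (auto simp: K_def)
    qed
    thus ?thesis by blast
  qed
  hence "q * q \<le> (\<Sum>c\<in>K. card {x. x ^ q = x + c})"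
    by (metis qq card_UN_le finite)
  also have "\<dots> \<le> card K * q"
    using sum_bounded_above[of K "\<lambda>c. card {x. x ^ q = x + c}" q] bound by simp
  finally have "card K = q"
    using q le by simp
  moreover have "L = K" if "is_subfield L" "card L = q" for L
  proof (rule card_subset_eq)
    show "L \<subseteq> K"
      using subfield_power_card[OF that(1)] that(2) by (auto simp: K_def)
  qed (use that \<open>card K = q\<close> in auto)
  ultimately show ?thesis
    using sub unfolding q_def by blast
qed

end

theory Submission
  imports Defs
begin

text \<open>
  Scaling reduces everything to \<open>a = 1\<close>, i.e. to the fibres of
  \<open>x \<mapsto> F x + F (x + 1)\<close>.

  For \<open>n = 2m + 1\<close> the power mapping is, up to a Frobenius automorphism, the inverse of the
  Gold permutation \<open>y \<mapsto> y ^ (2 ^ m + 1)\<close>; substituting the latter turns the equation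
  of a fibre into an affine one. For \<open>n = 2m\<close> write \<open>y = x ^ (2 ^ m)\<close>; then
  \<open>F x = y\<^sup>2 / x\<close>, and a fibre over \<open>t \<noteq> 1\<close> consists of the solutions of
  \<open>x\<^sup>2 + x = u\<^sup>2 / (t + 1)\<close> whose relative trace \<open>x + y\<close> is a certain
  element \<open>u\<close> determined by \<open>t\<close>. In both cases additive Hilbert 90, obtained by
  counting, says that the affine equation has two solutions or none according to a trace. Hence
  these fibres have the form \<open>{z, z + 1}\<close> or are empty, and no fibre of this kind meets its
  translate by \<open>b \<notin> {0, 1}\<close>; only the fibre over \<open>t = 1\<close> for
  \<open>n = 2m\<close>, which is the subfield of order \<open>2 ^ m\<close>, survives such a shift.
\<close>

subsection \<open>Characteristic two and traces\<close>

lemma frobenius_add: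
  assumes "CHAR('a::finite_field) = 2"
  shows "(x + y :: 'a) ^ (2 ^ k) = x ^ (2 ^ k) + y ^ (2 ^ k)"
  by (rule freshmans_dream'[where n = k]) (simp_all add: assms)

lemma square_add_char_2:
  assumes "CHAR('a::finite_field) = 2"
  shows "(x + y :: 'a) ^ 2 = x ^ 2 + y ^ 2"
  using frobenius_add[OF assms, of x y 1] by (simp only: power_one_right)

lemma add_self_char_2:
  assumes "CHAR('a::ring_1) = 2"
  shows "x + x = (0::'a)" "x + (x + y) = y"
proof -
  show "x + x = 0"
    using uminus_CHAR_2[OF assms, of x] by (metis add.right_inverse)
  thus "x + (x + y) = y"
    by (metis add.assoc add_0)
qed

text \<open>Every element is its own negative, so a summand crosses the equality sign unchanged.
  This takes the place of subtraction in most later computations.\<close>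

lemma add_eq_iff_char_2:
  assumes "CHAR('a::ring_1) = 2"
  shows "x + y = z \<longleftrightarrow> x = y + (z :: 'a)"
proof
  assume "x + y = z"
  thus "x = y + z"
    using add_self_char_2(2)[OF assms, of y x] by (simp add: add.commute)
next
  assume "x = y + z"
  thus "x + y = z"
    using add_self_char_2(2)[OF assms, of y z] by (simp add: add.commute)
qed

lemma eq_iff_add_eq_0_char_2:
  assumes "CHAR('a::ring_1) = 2"
  shows "x = y \<longleftrightarrow> x + y = (0 :: 'a)"
  using add_eq_iff_char_2[OF assms, of x y 0] by simp

lemma square_add_self_eq_0_iff:
  assumes "CHAR('a::{ring_1, ring_no_zero_divisors}) = 2"
  shows "x ^ 2 + x = 0 \<longleftrightarrow> x \<in> {0, 1 :: 'a}"
proof -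
  have "x ^ 2 + x = x * (x + 1)"
    by (simp add: power2_eq_square distrib_left)
  thus ?thesis
    using add_eq_iff_char_2[OF assms, of x 1 0] by simp
qed

text \<open>By additivity, equal powers give \<open>(x + y) ^ (2 ^ k) = 0\<close>, and a field has
  no nilpotents.\<close>

lemma frobenius_inject:
  assumes "CHAR('a::finite_field) = 2"
  shows "(x :: 'a) ^ (2 ^ k) = y ^ (2 ^ k) \<longleftrightarrow> x = y"
  using eq_iff_add_eq_0_char_2[OF assms, of x y]
    eq_iff_add_eq_0_char_2[OF assms, of "x ^ (2 ^ k)" "y ^ (2 ^ k)"]
  by (simp flip: frobenius_add[OF assms])

section \<open>The absolute trace and its values\<close>

lemma Tr_add_index: "Tr (k + l) (x :: 'a::finite_field) = Tr k x + Tr l (x ^ (2 ^ k))"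
  by (induction l) (simp_all add: Tr_def power_add power_mult add.assoc)

lemma Tr_add:
  assumes "CHAR('a::finite_field) = 2"
  shows "Tr k (x + y :: 'a) = Tr k x + Tr k y"
  by (simp add: Tr_def frobenius_add[OF assms] sum.distrib)

lemma Tr_zero: "Tr k (0 :: 'a::finite_field) = 0"
  by (simp add: Tr_def power_0_left)

lemma Tr_one: "Tr k (1 :: 'a::finite_field) = of_nat k"
  by (simp add: Tr_def)

text \<open>The sum telescopes, because the inner powers cancel in pairs. In the field of degree
  \<open>2 * m\<close> the right side vanishes for \<open>k = 2 * m\<close> and is the relative
  trace of \<open>x\<close> for \<open>k = m\<close>.\<close>

lemma Tr_square_add:
  assumes "CHAR('a::finite_field) = 2"
  shows "Tr k (x ^ 2 + x :: 'a) = x ^ (2 ^ k) + x"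
proof (induction k)
  case 0
  show ?case by (simp add: Tr_def add_self_char_2[OF assms])
next
  case (Suc k)
  have "Tr (Suc k) (x ^ 2 + x) = Tr k (x ^ 2 + x) + (x ^ 2 + x) ^ 2 ^ k"
    by (simp add: Tr_def)
  also have "\<dots> = x ^ (2 ^ Suc k) + x + (x ^ 2 ^ k + x ^ 2 ^ k)"
    unfolding Suc.IH by (simp add: frobenius_add[OF assms] add_ac flip: power_mult)
  finally show ?case
    by (simp add: add_self_char_2[OF assms])
qed

lemma Tr_square:
  assumes "CHAR('a::finite_field) = 2" and "x ^ (2 ^ k) = (x :: 'a)"
  shows "Tr k (x ^ 2) = Tr k x"
proof -
  have "Tr k (x ^ 2) + Tr k x = 0"
    using Tr_square_add[OF assms(1), of k x]
    by (simp add: assms(2) Tr_add[OF assms(1)] add_self_char_2[OF assms(1)])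
  thus ?thesis
    using eq_iff_add_eq_0_char_2[OF assms(1)] by blast
qed

lemma Tr_frobenius:
  assumes "CHAR('a::finite_field) = 2" and "x ^ (2 ^ k) = (x :: 'a)"
  shows "Tr k (x ^ (2 ^ i)) = Tr k x"
proof (induction i)
  case (Suc i)
  have "(x ^ 2 ^ i) ^ 2 ^ k = x ^ 2 ^ i"
    by (metis assms(2) mult.commute power_mult)
  hence "Tr k ((x ^ 2 ^ i) ^ 2) = Tr k (x ^ 2 ^ i)"
    by (rule Tr_square[OF assms(1)])
  thus ?case
    using Suc by (simp add: mult.commute flip: power_mult)
qed simp

text \<open>Squaring commutes with the sum and permutes its terms cyclically, so the value is a root
  of \<open>z ^ 2 + z\<close>.\<close>

lemma Tr_in_prime_field:
  assumes "CHAR('a::finite_field) = 2" and "x ^ (2 ^ k) = (x :: 'a)"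
  shows "Tr k x \<in> {0, 1}"
proof -
  have "Tr l (x ^ 2) = Tr l x ^ 2" for l
    by (induction l) (simp_all add: Tr_def square_add_char_2[OF assms(1)] mult.commute
        flip: power_mult)
  hence "Tr k x ^ 2 + Tr k x = 0"
    using Tr_square[OF assms] by (simp add: add_self_char_2[OF assms(1)])
  thus ?thesis
    using square_add_self_eq_0_iff[OF assms(1)] by blast
qed

section \<open>Additive Hilbert 90 by counting\<close>

lemma card_Tr_eq_0_le:
  assumes "n > 0"
  shows "card {x :: 'a::finite_field. Tr n x = 0} \<le> 2 ^ (n - 1)"
proof -
  define p :: "'a poly" where "p = (\<Sum>i<n. monom 1 (2 ^ i))"
  obtain k where n: "n = Suc k"
    using assms by (cases n) auto
  \<comment> \<open>The top exponent exceeds all the others, so splitting off its monomial gives the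
    degree of the trace polynomial.\<close>
  have deg: "degree (\<Sum>i<k. monom 1 (2 ^ i) :: 'a poly) < 2 ^ k"
    by (rule degree_sum_less) (auto simp: degree_monom_eq)
  have "degree p = 2 ^ k"
    unfolding p_def n using deg by (simp add: degree_add_eq_right degree_monom_eq)
  moreover from this have "p \<noteq> 0"
    by auto
  moreover have "{x. Tr n x = 0} = {x. poly p x = 0}"
    by (simp add: Tr_def p_def poly_sum poly_monom)
  ultimately show ?thesis
    using card_poly_roots_bound[of p] by (simp add: n)
qed

text \<open>
  All fibres of \<open>L\<close> have at most two elements, so its range has at least \<open>2 ^ (n - 1)\<close>
  elements, which is as many as the trace polynomial can have roots.
\<close>
lemma fibre_of_trace_zero:
  fixes L :: "'a::finite_field \<Rightarrow> 'a"
  assumes card: "CARD('a) = 2 ^ n" and n: "n > 0"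
    and add: "\<And>x y. L (x + y) = L x + L y"
    and ker: "\<And>x. L x = 0 \<longleftrightarrow> x \<in> {0, 1}"
    and Tr: "\<And>x. Tr n (L x) = 0" and c: "Tr n c = 0"
  obtains x where "{y. L y = c} = {x, x + 1}"
proof -
  note char = CHAR_eq_2[OF card]
  have fibre: "{y. L y = L x} = {x, x + 1}" for x
  proof -
    have "L y = L x \<longleftrightarrow> y + x \<in> {0, 1}" for y
      using ker[of "y + x"] eq_iff_add_eq_0_char_2[OF char, of "L y" "L x"] by (simp add: add)
    thus ?thesis
      by (auto simp: add_eq_iff_char_2[OF char] add.commute)
  qed
  have "(\<Union>c\<in>range L. {y. L y = c}) = UNIV"
    by auto
  hence "2 ^ n \<le> (\<Sum>c\<in>range L. card {y. L y = c})"
    using card_UN_le[of "range L" "\<lambda>c. {y. L y = c}"] unfolding card[symmetric] by simp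
  also have "\<dots> \<le> (\<Sum>c\<in>range L. 2)"
    by (rule sum_mono) (auto simp: fibre card_insert_if)
  also have "\<dots> = 2 * card (range L)"
    by simp
  finally have "2 ^ (n - 1) \<le> card (range L)"
    using n by (cases n) auto
  hence "card {x :: 'a. Tr n x = 0} \<le> card (range L)"
    using card_Tr_eq_0_le[OF n, where ?'a = 'a] by linarith
  hence "range L = {x. Tr n x = 0}"
    by (intro card_seteq) (use Tr in auto)
  then obtain x where "c = L x"
    using c by auto
  thus ?thesis
    using that fibre by blast
qed

text \<open>Every element of the subfield is a root of \<open>X ^ (2 ^ m) - X\<close>, which has at
  most \<open>2 ^ m\<close> roots. This turns the \<open>THE\<close> description into the fixed set
  of conjugation.\<close>

lemma subfield_of_order_eq:
  assumes m: "m > 0" and card: "CARD('a::finite_field) = 2 ^ (2 * m)"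
  shows "(subfield_of_order (2 ^ m) :: 'a set) = {x. x ^ (2 ^ m) = x}"
    and "card {x :: 'a. x ^ (2 ^ m) = x} = 2 ^ m"
proof -
  define K :: "'a set" where "K = subfield_of_order (2 ^ m)"
  have K: "is_subfield K" "card K = 2 ^ m"
    using theI'[OF ex1_subfield_of_order[OF m card]]
    by (simp_all add: K_def subfield_of_order_def)
  define p :: "'a poly" where "p = monom 1 (2 ^ m) + [:0, -1:]"
  \<comment> \<open>For \<open>m = 0\<close> the two terms of \<open>p\<close> would cancel; the
    strict inequality makes the power term leading.\<close>
  have "(1 :: nat) < 2 ^ m"
    using m one_less_power[of "2 :: nat" m] by simp
  hence p: "degree p = 2 ^ m"
    by (simp add: p_def degree_add_eq_left degree_monom_eq)
  hence "p \<noteq> 0" by auto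
  moreover have "{x. x ^ (2 ^ m) = x} = {x. poly p x = 0}"
    by (simp add: p_def poly_monom)
  ultimately have "card {x :: 'a. x ^ (2 ^ m) = x} \<le> card K"
    using card_poly_roots_bound[of p] p K by simp
  hence eq: "K = {x. x ^ (2 ^ m) = x}"
    by (intro card_seteq) (use subfield_power_card[OF K(1)] K(2) in auto)
  show "(subfield_of_order (2 ^ m) :: 'a set) = {x. x ^ (2 ^ m) = x}"
    using eq by (simp add: K_def)
  show "card {x :: 'a. x ^ (2 ^ m) = x} = 2 ^ m"
    using K eq by simp
qed

subsection \<open>Reduction to fibres of the derivative\<close>

lemma FBDT_zero_left:
  assumes "CHAR('a::finite_field) = 2"
  shows "FBDT F 0 c (b :: 'a) = (if c = 0 then CARD('a) else 0)"
  by (auto simp: FBDT_def add_self_char_2[OF assms] add.assoc)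

text \<open>Once the derivative at \<open>x\<close> equals \<open>c\<close>, the fourfold sum
  vanishes exactly when the derivative at \<open>x + b\<close> is \<open>c\<close> too. The entry
  thus counts the intersection of a fibre with its translate by \<open>b\<close>.\<close>

lemma FBDT_eq_derivative:
  assumes "CHAR('a::finite_field) = 2"
  shows "FBDT F a c (b :: 'a) =
    card {x. F x + F (x + a) = c \<and> F (x + b) + F (x + b + a) = c}"
proof -
  have "u + v + w + z = 0 \<and> u + v = c \<longleftrightarrow> u + v = c \<and> w + z = c" for u v w z
    using eq_iff_add_eq_0_char_2[OF assms, of "u + v" "w + z"] by (auto simp: add.assoc)
  thus ?thesis
    by (simp add: FBDT_def add.assoc add.commute[of a b])
qed

lemma pow_F_zero_one: "pow_F m 0 = 0" "pow_F m 1 = 1"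
proof -
  have "(1 :: nat) < 2 ^ (m + 1)"
    by (rule one_less_power) simp_all
  thus "pow_F m 0 = 0" "pow_F m 1 = 1"
    by (simp_all add: pow_F_def power_0_left)
qed

text \<open>The power mapping is multiplicative, so the substitution of \<open>x / a\<close> for
  \<open>x\<close> normalises the difference to 1.\<close>

lemma FBDT_pow_F_scale:
  fixes a b c :: "'a::finite_field"
  assumes char: "CHAR('a) = 2" and a: "a \<noteq> 0"
  shows "FBDT (pow_F m) a c b = FBDT (pow_F m) 1 (t_of m a c) (b / a)"
proof -
  have t: "u = c \<longleftrightarrow> u / pow_F m a = t_of m a c" for u
    using a by (auto simp: t_of_def pow_F_def)
  have div: "pow_F m x / pow_F m a = pow_F m (x / a)" for x
    by (simp add: pow_F_def power_divide)
  have "bij_betw (\<lambda>x. x / a)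
      {x. pow_F m x + pow_F m (x + a) = c \<and> pow_F m (x + b) + pow_F m (x + b + a) = c}
      {x. pow_F m x + pow_F m (x + 1) = t_of m a c \<and>
          pow_F m (x + b / a) + pow_F m (x + b / a + 1) = t_of m a c}"
    by (rule bij_betw_byWitness[where f' = "\<lambda>x. x * a"])
       (use a in \<open>auto simp: t add_divide_distrib div\<close>)
  thus ?thesis
    unfolding FBDT_eq_derivative[OF char] by (rule bij_betw_same_card)
qed

text \<open>Shifting by 1 only swaps the two summands of the derivative.\<close>

lemma FBDT_1_trivial_shift:
  assumes char: "CHAR('a::finite_field) = 2" and b: "b \<in> {0, 1 :: 'a}"
  shows "FBDT F 1 c b = card {x. F x + F (x + 1) = c}"
proof -
  have "F (x + b) + F (x + b + 1) = F x + F (x + 1)" for x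
    using b by (auto simp: add.assoc add_self_char_2[OF char] add.commute)
  thus ?thesis
    unfolding FBDT_eq_derivative[OF char] by simp
qed

text \<open>Two points of \<open>{z, z + 1}\<close> differ by 0 or 1, hence never by
  \<open>b\<close>.\<close>

lemma FBDT_1_eq_0:
  assumes char: "CHAR('a::finite_field) = 2" and b: "b \<notin> {0, 1 :: 'a}"
    and sub: "{x. F x + F (x + 1) = c} \<subseteq> {z, z + 1}"
  shows "FBDT F 1 c b = 0"
proof -
  have "x + b \<notin> {z, z + 1}" if "x \<in> {z, z + 1}" for x
    using that b by (auto simp: add.assoc add_eq_iff_char_2[OF char] add_self_char_2[OF char])
  hence "{x. F x + F (x + 1) = c \<and> F (x + b) + F (x + b + 1) = c} = {}"
    using sub by auto
  thus ?thesis
    unfolding FBDT_eq_derivative[OF char] by simp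
qed

subsection \<open>Fields of odd degree\<close>

text \<open>The two exponents multiply to \<open>2 ^ (2 * m + 1) + (2 ^ m - 1)\<close>, and raising
  to the field order is the identity. In the proof \<open>k\<close> is
  \<open>2 ^ m - 1\<close>.\<close>

lemma pow_F_gold:
  assumes "CARD('a::finite_field) = 2 ^ (2 * m + 1)"
  shows "pow_F m (y ^ (2 ^ m + 1)) = (y :: 'a) ^ (2 ^ m)"
proof -
  obtain k where k: "(2 :: nat) ^ m = Suc k"
    by (metis not0_implies_Suc power_not_zero zero_neq_numeral)
  have "(2 ^ m + 1) * (2 ^ (m + 1) - 1) = CARD('a) + k"
    unfolding assms power_add mult_2[of m] k by simp
  hence "pow_F m (y ^ (2 ^ m + 1)) = y ^ CARD('a) * y ^ k"
    unfolding pow_F_def by (metis power_add power_mult)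
  thus ?thesis
    by (simp add: finite_field_power_card_eq_same k)
qed

text \<open>The composite of the two maps is an iterated Frobenius, which is injective. So the Gold
  map is injective, by finiteness bijective, and the injectivity of \<open>pow_F\<close>
  follows.\<close>

lemma
  assumes card: "CARD('a::finite_field) = 2 ^ (2 * m + 1)"
  shows bij_gold: "bij (\<lambda>y :: 'a. y ^ (2 ^ m + 1))"
    and inj_pow_F: "inj (pow_F m :: 'a \<Rightarrow> 'a)"
proof -
  note char = CHAR_eq_2[OF card]
  define G where "G = (\<lambda>y :: 'a. y ^ (2 ^ m + 1))"
  have FG: "pow_F m (G y) = y ^ (2 ^ m)" for y
    unfolding G_def by (rule pow_F_gold[OF card])
  have "inj G"
    by (rule injI) (metis FG frobenius_inject[OF char])
  thus bij: "bij G"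
    by (simp add: bij_def finite_UNIV_inj_surj)
  show "inj (pow_F m :: 'a \<Rightarrow> 'a)"
  proof (rule injI)
    fix x y :: 'a
    obtain x' y' where "x = G x'" "y = G y'"
      using bij by (meson bij_pointE)
    moreover assume "pow_F m x = pow_F m y"
    ultimately show "x = y"
      by (simp add: FG frobenius_inject[OF char])
  qed
qed

text \<open>As \<open>m\<close> and \<open>2 * m + 1\<close> are coprime, only the prime field is
  fixed: two applications of the power and one squaring give back \<open>x\<close>, whence
  \<open>x = x ^ 2\<close>.\<close>

lemma frobenius_fixed_odd:
  assumes card: "CARD('a::finite_field) = 2 ^ (2 * m + 1)" and x: "(x :: 'a) ^ (2 ^ m) = x"
  shows "x \<in> {0, 1}"
proof -
  have "x = x ^ (2 ^ m * 2 ^ m * 2)"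
    using finite_field_power_card_eq_same[of x] unfolding card power_add mult_2[of m] by simp
  also have "\<dots> = x ^ 2"
    by (simp add: power_mult x)
  finally have "x * (x - 1) = 0"
    by (simp add: power2_eq_square algebra_simps)
  thus ?thesis
    by simp
qed

text \<open>
  With \<open>x = y ^ (2 ^ m + 1)\<close>, \<open>t = s ^ (2 ^ m)\<close> and \<open>y = s * w\<close> the equation becomes
  \<open>w ^ (2 ^ m) + w = 1 + 1 / s ^ (2 ^ m + 1)\<close>.
\<close>
lemma derivative_fibre_odd:
  fixes t :: "'a::finite_field"
  assumes card: "CARD('a) = 2 ^ (2 * m + 1)"
  defines "S \<equiv> {x. pow_F m x + pow_F m (x + 1) = t}"
  shows "Tr (2 * m + 1) (1 / t ^ (2 ^ m + 1)) = 1 \<Longrightarrow> \<exists>z. S = {z, z + 1}"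
    and "Tr (2 * m + 1) (1 / t ^ (2 ^ m + 1)) = 0 \<Longrightarrow> S = {}"
proof -
  note char = CHAR_eq_2[OF card]
  define n where "n = 2 * m + 1"
  define q :: nat where "q = 2 ^ m"
  define G where "G = (\<lambda>y :: 'a. y ^ (q + 1))"
  \<comment> \<open>This is the \<open>q\<close>-th root of \<open>t\<close>, because
    \<open>2 * q * q\<close> is the order of the field.\<close>
  define s where "s = t ^ (2 * q)"
  have q_add: "(x + y) ^ q = x ^ q + y ^ q" for x y :: 'a
    unfolding q_def by (rule frobenius_add[OF char])
  have s: "s ^ q = t"
    using finite_field_power_card_eq_same[of t]
    unfolding card power_add mult_2[of m] s_def q_def by (simp add: ac_simps mult_2 distrib_left flip: power_mult)
  have FG: "pow_F m (G y) = y ^ q" for y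
    unfolding G_def q_def by (rule pow_F_gold[OF card])
  have bij: "bij G"
    unfolding G_def q_def by (rule bij_gold[OF card])
  have inj: "pow_F m x = pow_F m y \<longleftrightarrow> x = y" for x y :: 'a
    using inj_pow_F[OF card] by (auto simp: inj_eq)
  \<comment> \<open>The required value \<open>y ^ q + s ^ q\<close> is itself the image of
    \<open>G (y + s)\<close> under \<open>pow_F m\<close>, so injectivity removes
    \<open>pow_F\<close> and leaves an equation affine in \<open>y\<close>.\<close>
  have G_mem: "G y \<in> S \<longleftrightarrow> y ^ q * s + y * t + s * t = 1" for y
  proof -
    have "G y \<in> S \<longleftrightarrow> pow_F m (G y + 1) = y ^ q + s ^ q"
      using add_eq_iff_char_2[OF char, of "pow_F m (G y + 1)" "y ^ q" t]
      by (simp add: S_def FG s add.commute)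
    also have "\<dots> \<longleftrightarrow> pow_F m (G y + 1) = pow_F m (G (y + s))"
      by (simp add: FG q_add)
    also have "\<dots> \<longleftrightarrow> G (y + s) = G y + 1"
      unfolding inj by auto
    also have "G (y + s) = G y + (y ^ q * s + y * t + s * t)"
      by (simp add: G_def q_add s algebra_simps)
    finally show ?thesis by simp
  qed
  have Tr_t: "Tr n (1 / s ^ (q + 1)) = Tr n (1 / t ^ (q + 1))"
  proof -
    have "(1 / s ^ (q + 1)) ^ 2 ^ m = 1 / t ^ (q + 1)"
      unfolding q_def[symmetric] by (simp add: power_divide s power_mult_distrib)
    moreover have "x ^ (2 ^ n) = x" for x :: 'a
      using finite_field_power_card_eq_same[of x] by (simp add: card n_def)
    ultimately show ?thesis
      using Tr_frobenius[OF char, of "1 / s ^ (q + 1)" n m] by metis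
  qed
  have Tr_w: "Tr n (w ^ q + w) = 0" for w :: 'a
  proof -
    have "w ^ (2 ^ n) = w"
      using finite_field_power_card_eq_same[of w] by (simp add: card n_def)
    thus ?thesis
      using Tr_frobenius[OF char, of w n m]
      by (simp add: Tr_add[OF char] q_def add_self_char_2[OF char])
  qed
  \<comment> \<open>The degree is odd. This is why solvability of the affine equation means trace 1,
    not trace 0, of the reciprocal.\<close>
  have Tr_n_one: "Tr n (1 :: 'a) = 1"
  proof -
    have "(2 :: 'a) = 0"
      using of_nat_CHAR[where ?'a = 'a] by (simp add: char)
    thus ?thesis
      unfolding Tr_one n_def of_nat_add of_nat_mult by simp
  qed
  have scaled: "G (s * w) \<in> S \<longleftrightarrow> w ^ q + w = 1 + 1 / s ^ (q + 1)" if "s \<noteq> 0" for w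
  proof -
    have "G (s * w) \<in> S \<longleftrightarrow> s ^ (q + 1) * (w ^ q + w + 1) = 1"
      unfolding G_mem by (simp add: power_mult_distrib s algebra_simps)
    also have "\<dots> \<longleftrightarrow> w ^ q + w + 1 = 1 / s ^ (q + 1)"
      using that by (simp add: field_simps)
    also have "\<dots> \<longleftrightarrow> w ^ q + w = 1 + 1 / s ^ (q + 1)"
      using add_eq_iff_char_2[OF char, of "w ^ q + w" 1 "1 / s ^ (q + 1)"]
        add_eq_iff_char_2[OF char, of 1 "w ^ q + w" "1 / s ^ (q + 1)"]
      by (auto simp: add.commute)
    finally show ?thesis .
  qed
  have S_eq: "S = G ` {y. G y \<in> S}"
    using surj_image_vimage_eq[OF bij_is_surj[OF bij], of S] by (simp add: vimage_def)
  show "\<exists>z. S = {z, z + 1}" if Tr1: "Tr (2 * m + 1) (1 / t ^ (2 ^ m + 1)) = 1"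
  proof -
    have "t \<noteq> 0"
      using Tr1 by (auto simp: Tr_zero)
    hence "s \<noteq> 0" by (simp add: s_def)
    have "w ^ q + w = 0 \<longleftrightarrow> w \<in> {0, 1}" for w :: 'a
      using frobenius_fixed_odd[OF card, of w] eq_iff_add_eq_0_char_2[OF char, of "w ^ q" w]
      by (auto simp: q_def)
    moreover have "Tr n (1 + 1 / s ^ (q + 1)) = 0"
      using Tr1[folded n_def q_def]
      unfolding Tr_add[OF char] Tr_t Tr_n_one by (simp add: add_self_char_2[OF char])
    ultimately obtain w where "{v. v ^ q + v = 1 + 1 / s ^ (q + 1)} = {w, w + 1}"
      using fibre_of_trace_zero[of n "\<lambda>w. w ^ q + w" "1 + 1 / s ^ (q + 1)"] Tr_w
      by (auto simp: card n_def q_add add_ac)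
    hence w: "G (s * v) \<in> S \<longleftrightarrow> v \<in> {w, w + 1}" for v
      using scaled[OF \<open>s \<noteq> 0\<close>] by blast
    have "G y \<in> S \<longleftrightarrow> y \<in> {s * w, s * w + s}" for y
    proof -
      have "y / s \<in> {w, w + 1} \<longleftrightarrow> y \<in> {s * w, s * w + s}"
        using \<open>s \<noteq> 0\<close> by (simp add: divide_eq_eq distrib_left mult.commute)
      thus ?thesis
        using w[of "y / s"] \<open>s \<noteq> 0\<close> by simp
    qed
    hence S2: "S = {G (s * w), G (s * w + s)}"
      using S_eq by auto
    \<comment> \<open>That the two elements differ by 1 needs no calculation: the fibre is closed
      under adding 1.\<close>
    moreover have "G (s * w) + 1 \<in> S"
      using w[of w] by (simp add: S_def add.assoc add_self_char_2[OF char] add.commute)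
    ultimately have "G (s * w) + 1 = G (s * w + s)"
      by auto
    thus ?thesis
      using S2 by metis
  qed
  show "S = {}" if Tr0: "Tr (2 * m + 1) (1 / t ^ (2 ^ m + 1)) = 0"
  proof (cases "t = 0")
    case True
    hence "G y \<notin> S" for y
      unfolding G_mem by (simp add: s_def q_def power_0_left)
    thus ?thesis using S_eq by auto
  next
    case False
    hence "s \<noteq> 0" by (simp add: s_def)
    have "Tr n (1 + 1 / s ^ (q + 1)) = 1"
      using Tr0[folded n_def q_def]
      unfolding Tr_add[OF char] Tr_t Tr_n_one by simp
    hence "w ^ q + w \<noteq> 1 + 1 / s ^ (q + 1)" for w
      using Tr_w[of w] by auto
    hence "G y \<notin> S" for y
      using scaled[OF \<open>s \<noteq> 0\<close>, of "y / s"] \<open>s \<noteq> 0\<close> by simp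
    thus ?thesis using S_eq by auto
  qed
qed

subsection \<open>Fields of even degree\<close>

text \<open>
  Here \<open>y\<close> is the conjugate \<open>x ^ (2 ^ m)\<close>, in terms of which \<open>pow_F m x = y\<^sup>2 / x\<close>.
\<close>
lemma derivative_eq_conjugate:
  fixes x t :: "'a::finite_field" and m :: nat
  assumes char: "CHAR('a) = 2" and x: "x \<notin> {0, 1}"
  defines "y \<equiv> x ^ (2 ^ m)"
  shows "pow_F m x + pow_F m (x + 1) = t \<longleftrightarrow> y ^ 2 + x = t * (x ^ 2 + x)"
proof -
  have F: "pow_F m z = (z ^ (2 ^ m)) ^ 2 / z" if "z \<noteq> 0" for z :: 'a
  proof -
    have "2 ^ m * 2 = Suc (2 ^ (m + 1) - 1 :: nat)"
      by simp
    hence "(z ^ (2 ^ m)) ^ 2 = z ^ (2 ^ (m + 1) - 1) * z"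
      by (metis power_Suc2 power_mult)
    thus ?thesis
      using that by (simp add: pow_F_def)
  qed
  have x1: "x \<noteq> 0" "x + 1 \<noteq> 0"
    using x add_eq_iff_char_2[OF char, of x 1 0] by auto
  have sq: "(y + 1) ^ 2 = y ^ 2 + 1"
    using square_add_char_2[OF char, of y 1] by simp
  have "pow_F m x + pow_F m (x + 1) = y ^ 2 / x + (y + 1) ^ 2 / (x + 1)"
    using x1 by (simp add: F y_def frobenius_add[OF char])
  also have "\<dots> = (y ^ 2 + x + (x * y ^ 2 + x * y ^ 2)) / (x ^ 2 + x)"
    unfolding sq add_frac_eq[OF x1] by (simp add: algebra_simps power2_eq_square)
  also have "\<dots> = (y ^ 2 + x) / (x ^ 2 + x)"
    by (simp add: add_self_char_2[OF char])
  finally show ?thesis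
    using square_add_self_eq_0_iff[OF char, of x] x by (simp add: divide_eq_eq)
qed

section \<open>Fibres of the derivative through conjugation\<close>

context
  fixes m :: nat
  assumes card: "CARD('a::finite_field) = 2 ^ (2 * m)"
begin

private lemmas char = CHAR_eq_2[OF card]

lemma conj_conj: "((x :: 'a) ^ (2 ^ m)) ^ (2 ^ m) = x"
  using finite_field_power_card_eq_same[of x]
  unfolding card mult_2 power_add power_mult by simp

lemma conj_add: "(x + y :: 'a) ^ (2 ^ m) = x ^ (2 ^ m) + y ^ (2 ^ m)"
  by (rule frobenius_add[OF char])

text \<open>For \<open>t = 1\<close> the conjugate equation collapses to
  \<open>y ^ 2 = x ^ 2\<close>, that is \<open>y = x\<close>.\<close>

lemma derivative_fibre_even_1:
  "{x :: 'a. pow_F m x + pow_F m (x + 1) = 1} = {x. x ^ (2 ^ m) = x}"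
proof -
  have "pow_F m x + pow_F m (x + 1) = 1 \<longleftrightarrow> x ^ (2 ^ m) = x" for x :: 'a
  proof (cases "x \<in> {0, 1}")
    case True
    thus ?thesis
      by (auto simp: pow_F_zero_one add_self_char_2[OF char])
  next
    case False
    show ?thesis
      unfolding derivative_eq_conjugate[OF char False]
      using frobenius_inject[OF char, of "x ^ 2 ^ m" 1 x] by simp
  qed
  thus ?thesis by blast
qed

text \<open>Adding \<open>x ^ 2 + x\<close> to both sides gives
  \<open>w ^ 2 = s * (x ^ 2 + x)\<close> with \<open>w = x + y\<close>. Comparing this with its
  conjugate, where \<open>w\<close> stays fixed, determines \<open>w\<close> from \<open>t\<close>
  alone.\<close>

lemma derivative_even_iff:
  fixes x t :: 'a
  assumes t: "t \<noteq> 1"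
  defines "s \<equiv> t + 1" and "P \<equiv> t ^ (2 ^ m + 1) + 1"
  defines "u \<equiv> s * s ^ (2 ^ m) / P"
  shows "pow_F m x + pow_F m (x + 1) = t \<longleftrightarrow>
    P \<noteq> 0 \<and> x ^ 2 + x = u ^ 2 / s \<and> x + x ^ (2 ^ m) = u"
proof -
  define s' where "s' = s ^ (2 ^ m)"
  define y where "y = x ^ (2 ^ m)"
  have s: "s \<noteq> 0" "s' \<noteq> 0"
    using t add_eq_iff_char_2[OF char, of t 1 0] by (auto simp: s_def s'_def)
  have P: "P = s * s' + s + s'"
    by (simp add: P_def s_def s'_def conj_add algebra_simps add_self_char_2[OF char])
  have u: "u = s * s' / P"
    by (simp add: u_def s'_def)
  show ?thesis
  proof (cases "x \<in> {0, 1}")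
    \<comment> \<open>At 0 and 1 the derivative is 1, which is not \<open>t\<close>; on the right,
      \<open>x ^ 2 + x = 0\<close> would force \<open>u = 0\<close>, impossible when
      \<open>P\<close> is nonzero.\<close>
    case True
    thus ?thesis
      using t s by (auto simp: pow_F_zero_one add_self_char_2[OF char] u)
  next
    case False
    have sq: "(x + y) ^ 2 = x ^ 2 + y ^ 2"
      by (rule square_add_char_2[OF char])
    have "x ^ 2 + x \<noteq> 0"
      using False square_add_self_eq_0_iff[OF char, of x] by simp
    have "pow_F m x + pow_F m (x + 1) = t \<longleftrightarrow> y ^ 2 + x = t * (x ^ 2 + x)"
      unfolding y_def by (rule derivative_eq_conjugate[OF char False])
    also have "\<dots> \<longleftrightarrow> y ^ 2 + x + (x ^ 2 + x) = t * (x ^ 2 + x) + (x ^ 2 + x)"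
      by (simp only: add_right_cancel)
    also have "\<dots> \<longleftrightarrow> (x + y) ^ 2 = s * (x ^ 2 + x)"
      unfolding sq by (simp add: s_def algebra_simps add_self_char_2[OF char])
    also have "\<dots> \<longleftrightarrow> P \<noteq> 0 \<and> x ^ 2 + x = u ^ 2 / s \<and> x + y = u" (is "?L \<longleftrightarrow> ?R")
    proof
      assume ?R
      thus ?L using s by simp
    next
      assume L: ?L
      define w where "w = x + y"
      have "w \<noteq> 0"
        using L s \<open>x ^ 2 + x \<noteq> 0\<close> by (auto simp: w_def)
      have w: "w ^ (2 ^ m) = w"
        by (simp add: w_def y_def conj_add conj_conj add.commute)
      have w1: "w ^ 2 = s' * (y ^ 2 + y)"
      proof -
        have "w ^ 2 = (w ^ 2) ^ (2 ^ m)"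
          using w by (metis mult.commute power_mult)
        also have "\<dots> = (s * (x ^ 2 + x)) ^ (2 ^ m)"
          using L by (simp add: w_def)
        also have "\<dots> = s' * (y ^ 2 + y)"
          unfolding power_mult_distrib conj_add s'_def y_def
          by (simp add: mult.commute flip: power_mult)
        finally show ?thesis .
      qed
      have w2: "w ^ 2 = s * (x ^ 2 + x)"
        using L by (simp add: w_def)
      \<comment> \<open>Weighting the equation by \<open>s'\<close> and its conjugate by
        \<open>s\<close> lets the right sides combine into an expression in \<open>w\<close> only;
        cancelling \<open>w\<close> then leaves \<open>w * P = s * s'\<close>.\<close>
      have "s' * w ^ 2 + s * w ^ 2 = s' * (s * (x ^ 2 + x)) + s * (s' * (y ^ 2 + y))"
        unfolding w1[symmetric] w2[symmetric] ..
      also have "\<dots> = s * s' * (x ^ 2 + y ^ 2 + (x + y))"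
        by (simp add: algebra_simps)
      also have "\<dots> = s * s' * w ^ 2 + s * s' * w"
        unfolding sq[symmetric] w_def[symmetric] by (rule distrib_left)
      finally have *: "s' * w ^ 2 + s * w ^ 2 = s * s' * w ^ 2 + s * s' * w" .
      have "w * (w * P) = s * s' * w ^ 2 + (s' * w ^ 2 + s * w ^ 2)"
        by (simp add: P power2_eq_square algebra_simps)
      also have "\<dots> = w * (s * s')"
        unfolding * by (simp add: add_self_char_2[OF char])
      finally have "w * (w * P) = w * (s * s')" .
      hence wP: "w * P = s * s'"
        using \<open>w \<noteq> 0\<close> by simp
      hence "P \<noteq> 0"
        using s by auto
      moreover from this have "w = u"
        using wP by (simp add: u field_simps)
      ultimately show ?R
        using L s by (simp add: w_def field_simps)
    qed
    finally show ?thesis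
      unfolding y_def .
  qed
qed

text \<open>
  Setting \<open>v = s / P\<close>, the element \<open>u\<^sup>2 / s + v\<^sup>2 + v\<close> lies in the subfield fixed by
  conjugation.
\<close>
lemma trace_condition:
  fixes t :: 'a
  assumes t: "t \<noteq> 1" and P0: "t ^ (2 ^ m + 1) \<noteq> 1"
  defines "s \<equiv> t + 1" and "P \<equiv> t ^ (2 ^ m + 1) + 1"
  defines "u \<equiv> s * s ^ (2 ^ m) / P"
  shows "Tr m (u ^ 2 / s) =
    Tr m ((t ^ (2 ^ m) + t + 1) / (t ^ (2 ^ (m + 1) + 2) + 1)) + u + 1"
    and "Tr (2 * m) (u ^ 2 / s) = 0" and "u ^ (2 ^ m) = u"
proof -
  define s' where "s' = s ^ (2 ^ m)"
  define v where "v = s / P"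
  define r where "r = s + s'"
  have s: "s \<noteq> 0" "s' \<noteq> 0"
    using t add_eq_iff_char_2[OF char, of t 1 0] by (auto simp: s_def s'_def)
  have P: "P = s * s' + s + s'"
    by (simp add: P_def s_def s'_def conj_add algebra_simps add_self_char_2[OF char])
  have "P \<noteq> 0"
    using P0 add_eq_iff_char_2[OF char, of "t ^ (2 ^ m + 1)" 1 0] by (auto simp: P_def)
  have u: "u = s * s' / P"
    by (simp add: u_def s'_def)
  have s'_conj: "s' ^ (2 ^ m) = s"
    by (simp add: s'_def conj_conj)
  have P_conj: "P ^ (2 ^ m) = P"
    by (simp add: P conj_add power_mult_distrib s'_conj s'_def[symmetric] ac_simps)
  show u_conj: "u ^ (2 ^ m) = u"
    by (simp add: u power_divide power_mult_distrib s'_conj s'_def[symmetric] P_conj mult.commute)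
  have r_conj: "r ^ (2 ^ m) = r"
    by (simp add: r_def conj_add s'_conj s'_def[symmetric] add.commute)
  have u1: "u = 1 + r / P"
  proof -
    have "s * s' = P + r"
      by (simp add: P r_def ac_simps add_self_char_2[OF char])
    thus ?thesis
      using \<open>P \<noteq> 0\<close> by (simp add: u field_simps)
  qed
  have v_conj: "v ^ (2 ^ m) + v = u + 1"
    by (simp add: v_def power_divide P_conj s'_def[symmetric] u1 r_def add_divide_distrib ac_simps
         add_self_char_2[OF char])
  \<comment> \<open>The brackets have the form \<open>z ^ 2 + z\<close> with \<open>z\<close> fixed
    by conjugation, so \<open>Tr m\<close> kills them. What remains, \<open>(r + 1) / P ^ 2\<close>,
    is the fraction of the statement.\<close>
  define B where "B = (r + 1) / P ^ 2 + ((r / P) ^ 2 + r / P) + ((1 / P) ^ 2 + 1 / P)"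
  have "u ^ 2 / s = B + (v ^ 2 + v)"
  proof -
    have "u ^ 2 / s + (v ^ 2 + v) = (s * s' ^ 2 + s ^ 2 + s * P) / P ^ 2"
    proof -
      have "u ^ 2 / s = s * s' ^ 2 / P ^ 2" "v ^ 2 = s ^ 2 / P ^ 2" "v = s * P / P ^ 2"
        using \<open>P \<noteq> 0\<close> s by (simp_all add: u v_def power2_eq_square)
      thus ?thesis
        by (simp only: add_divide_distrib add.assoc)
    qed
    also have "s * s' ^ 2 + s ^ 2 + s * P = (r + 1) + (r ^ 2 + r * P) + (1 + P)"
      unfolding P r_def by (simp add: algebra_simps power2_eq_square add_self_char_2[OF char])
    also have "\<dots> / P ^ 2 = B"
      using \<open>P \<noteq> 0\<close> by (simp add: B_def power_divide add_divide_distrib power2_eq_square)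
    finally show ?thesis
      using add_eq_iff_char_2[OF char, of "u ^ 2 / s" "v ^ 2 + v" B] by (simp add: add.commute)
  qed
  hence "Tr m (u ^ 2 / s) = Tr m B + (u + 1)"
    by (simp only: Tr_add[OF char, of m B] Tr_square_add[OF char] v_conj)
  also have "Tr m B = Tr m ((r + 1) / P ^ 2)"
    using P_conj r_conj unfolding B_def Tr_add[OF char, of m _ "_ ^ 2 + _"] Tr_square_add[OF char]
    by (simp add: power_divide add_self_char_2[OF char])
  also have "r + 1 = t ^ (2 ^ m) + t + 1"
    by (simp add: r_def s_def s'_def conj_add ac_simps add_self_char_2[OF char])
  also have "P ^ 2 = t ^ ((2 ^ m + 1) * 2) + 1"
    unfolding P_def square_add_char_2[OF char] power_mult power_one ..
  also have "(2 ^ m + 1) * 2 = (2 ^ (m + 1) + 2 :: nat)"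
    by simp
  finally show "Tr m (u ^ 2 / s) =
    Tr m ((t ^ (2 ^ m) + t + 1) / (t ^ (2 ^ (m + 1) + 2) + 1)) + u + 1"
    by (simp add: add.assoc)
  have "B ^ (2 ^ m) = B"
  proof -
    have "(z ^ 2) ^ (2 ^ m) = (z ^ (2 ^ m)) ^ 2" for z :: 'a
      by (simp add: mult.commute flip: power_mult)
    thus ?thesis
      by (simp only: B_def conj_add power_divide power_one P_conj r_conj)
  qed
  \<comment> \<open>In the full trace, the invariant \<open>B\<close> contributes
    \<open>Tr m B\<close> twice, and \<open>v ^ 2 + v\<close> telescopes to
    \<open>v + v\<close>.\<close>
  moreover have "(v ^ (2 ^ m)) ^ (2 ^ m) = v"
    by (rule conj_conj)
  ultimately show "Tr (2 * m) (u ^ 2 / s) = 0"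
    unfolding \<open>u ^ 2 / s = B + (v ^ 2 + v)\<close> Tr_add[OF char, of "2 * m" B] Tr_square_add[OF char]
    by (simp add: mult_2[of m] Tr_add_index Tr_add[OF char] mult_2 power_add power_mult add_self_char_2[OF char])
qed

text \<open>On solutions of \<open>x ^ 2 + x = u ^ 2 / s\<close> the relative trace of
  \<open>x\<close> is the constant \<open>Tr m (u ^ 2 / s)\<close>. So the second condition keeps
  both solutions or neither.\<close>

lemma derivative_fibre_even:
  fixes t :: 'a
  assumes m: "m > 0" and t: "t \<noteq> 1"
  defines "S \<equiv> {x. pow_F m x + pow_F m (x + 1) = t}"
    and "T \<equiv> Tr m ((t ^ (2 ^ m) + t + 1) / (t ^ (2 ^ (m + 1) + 2) + 1))"
  shows "\<exists>z. S \<subseteq> {z, z + 1}"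
    and "t ^ (2 ^ m + 1) = 1 \<Longrightarrow> S = {}"
    and "t ^ (2 ^ m + 1) \<noteq> 1 \<Longrightarrow> T = 1 \<Longrightarrow> \<exists>z. S = {z, z + 1}"
    and "t ^ (2 ^ m + 1) \<noteq> 1 \<Longrightarrow> T = 0 \<Longrightarrow> S = {}"
proof -
  define s where "s = t + 1"
  define P where "P = t ^ (2 ^ m + 1) + 1"
  define u where "u = s * s ^ (2 ^ m) / P"
  have P_iff: "P = 0 \<longleftrightarrow> t ^ (2 ^ m + 1) = 1"
    using add_eq_iff_char_2[OF char, of "t ^ (2 ^ m + 1)" 1 0] by (simp add: P_def)
  have S_iff: "x \<in> S \<longleftrightarrow> P \<noteq> 0 \<and> x ^ 2 + x = u ^ 2 / s \<and> Tr m (u ^ 2 / s) = u" for x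
    using derivative_even_iff[OF t, of x] Tr_square_add[OF char, of m x]
    by (auto simp: S_def u_def s_def P_def add.commute)
  show empty: "S = {}" if "t ^ (2 ^ m + 1) = 1"
    using that S_iff P_iff by blast
  \<comment> \<open>The value \<open>u + u + 1\<close> is 1; one \<open>u\<close> is the prescribed
    relative trace, the other comes from the trace formula.\<close>
  have "\<exists>z. S = (if T = u + u + 1 then {z, z + 1} else {})" if nz: "t ^ (2 ^ m + 1) \<noteq> 1"
  proof -
    note tr = trace_condition[OF t nz, folded s_def P_def T_def, folded u_def]
    obtain z where "{y. y ^ 2 + y = u ^ 2 / s} = {z, z + 1}"
    proof (rule fibre_of_trace_zero[OF card, of "\<lambda>x. x ^ 2 + x" "u ^ 2 / s"])
      show "(x + y) ^ 2 + (x + y) = x ^ 2 + x + (y ^ 2 + y)" for x y :: 'a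
        by (simp add: square_add_char_2[OF char] ac_simps)
      show "Tr (2 * m) (x ^ 2 + x) = 0" for x :: 'a
        unfolding Tr_square_add[OF char]
        using finite_field_power_card_eq_same[of x]
        by (simp add: card add_self_char_2[OF char])
    qed (use m tr(2) square_add_self_eq_0_iff[OF char] in auto)
    hence "x ^ 2 + x = u ^ 2 / s \<longleftrightarrow> x \<in> {z, z + 1}" for x
      by blast
    moreover have "Tr m (u ^ 2 / s) = u \<longleftrightarrow> T = u + u + 1"
      unfolding tr(1) using add_eq_iff_char_2[OF char, of T "u + 1" u] by (simp add: ac_simps)
    ultimately show ?thesis
      using S_iff nz P_iff by (intro exI[of _ z]) auto
  qed
  hence S_eq: "\<exists>z. S = (if T = 1 then {z, z + 1} else {})" if "t ^ (2 ^ m + 1) \<noteq> 1"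
    using that by (simp add: add_self_char_2[OF char])
  thus "\<exists>z. S \<subseteq> {z, z + 1}"
    using empty by (cases "t ^ (2 ^ m + 1) = 1"; cases "T = 1") auto
  show "\<exists>z. S = {z, z + 1}" if "t ^ (2 ^ m + 1) \<noteq> 1" "T = 1"
    using S_eq that by simp
  show "S = {}" if "t ^ (2 ^ m + 1) \<noteq> 1" "T = 0"
    using S_eq that by simp
qed

end

subsection \<open>Values of the table\<close>

lemma FBDT_odd:
  fixes a b c :: "'a::finite_field"
  assumes card: "CARD('a) = 2 ^ (2 * m + 1)"
  shows "(a, c, b) \<in> odd_I_2 m \<Longrightarrow> FBDT (pow_F m) a c b = 2"
    and "(a, c, b) \<in> odd_I_0_2 m \<Longrightarrow> FBDT (pow_F m) a c b = 0"
    and "(a, c, b) \<in> odd_I_0_3 \<Longrightarrow> FBDT (pow_F m) a c b = 0"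
proof -
  note char = CHAR_eq_2[OF card]
  note fibre = derivative_fibre_odd[OF card, of "t_of m a c"]
  note scale = FBDT_pow_F_scale[OF char, of a m c b]
  show "FBDT (pow_F m) a c b = 2" if "(a, c, b) \<in> odd_I_2 m"
    using that fibre(1) by (auto simp: odd_I_2_def scale FBDT_1_trivial_shift[OF char])
  show "FBDT (pow_F m) a c b = 0" if "(a, c, b) \<in> odd_I_0_2 m"
    using that fibre(2) by (auto simp: odd_I_0_2_def scale FBDT_1_trivial_shift[OF char])
  show "FBDT (pow_F m) a c b = 0" if "(a, c, b) \<in> odd_I_0_3"
  proof -
    have "b / a \<notin> {0, 1}" "a \<noteq> 0"
      using that by (auto simp: odd_I_0_3_def add_self_char_2[OF char])
    \<comment> \<open>The trace is 0 or 1, so one of the two fibre descriptions always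
      applies.\<close>
    moreover have "Tr (2 * m + 1) (1 / t_of m a c ^ (2 ^ m + 1)) \<in> {0, 1}"
      by (rule Tr_in_prime_field[OF char finite_field_power_card_eq_same[where ?'a = 'a, unfolded card]])
    then obtain z where "{x. pow_F m x + pow_F m (x + 1) = t_of m a c} \<subseteq> {z, z + 1}"
      using fibre by blast
    ultimately show ?thesis
      using FBDT_1_eq_0[OF char] scale by metis
  qed
qed

lemma FBDT_even_neq_1:
  fixes a b c :: "'a::finite_field"
  assumes m: "m > 0" and card: "CARD('a) = 2 ^ (2 * m)"
    and a: "a \<noteq> 0" and t: "t_of m a c \<noteq> 1" and b: "b \<notin> {0, a}"
  shows "FBDT (pow_F m) a c b = 0"
proof -
  note char = CHAR_eq_2[OF card]
  have "b / a \<notin> {0, 1}"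
    using a b by auto
  thus ?thesis
    using derivative_fibre_even(1)[OF card m t] FBDT_1_eq_0[OF char]
      FBDT_pow_F_scale[OF char a] by metis
qed

text \<open>The fibre over 1 is an additive subgroup, so it equals its translate by
  \<open>b / a\<close> or is disjoint from it.\<close>

lemma FBDT_even_eq_1:
  fixes a b c :: "'a::finite_field"
  assumes m: "m > 0" and card: "CARD('a) = 2 ^ (2 * m)"
    and a: "a \<noteq> 0" and t: "t_of m a c = 1"
  shows "FBDT (pow_F m) a c b = (if b / a \<in> subfield_of_order (2 ^ m) then 2 ^ m else 0)"
proof -
  note char = CHAR_eq_2[OF card]
  have fixed: "pow_F m x + pow_F m (x + 1) = 1 \<longleftrightarrow> x ^ (2 ^ m) = x" for x :: 'a
    using derivative_fibre_even_1[OF card] by blast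
  have "FBDT (pow_F m) a c b =
    card {x. x ^ (2 ^ m) = x \<and> (x + b / a) ^ (2 ^ m) = x + b / a}"
    by (simp only: FBDT_pow_F_scale[OF char a] t FBDT_eq_derivative[OF char, of _ 1] fixed)
  also have "{x. x ^ (2 ^ m) = x \<and> (x + b / a) ^ (2 ^ m) = x + b / a} =
    (if b / a \<in> subfield_of_order (2 ^ m) then {x. x ^ (2 ^ m) = x} else {})"
    by (auto simp: frobenius_add[OF char] subfield_of_order_eq(1)[OF m card])
  finally show ?thesis
    using subfield_of_order_eq(2)[OF m card] by simp
qed

lemma FBDT_even_trivial_shift:
  fixes a b c :: "'a::finite_field"
  assumes card: "CARD('a) = 2 ^ (2 * m)" and m: "m > 0"
    and a: "a \<noteq> 0" and b: "b \<in> {0, a}"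
  defines "t \<equiv> t_of m a c"
  defines "T \<equiv> Tr m ((t ^ (2 ^ m) + t + 1) / (t ^ (2 ^ (m + 1) + 2) + 1))"
  shows "t ^ (2 ^ m + 1) \<noteq> 1 \<Longrightarrow> T = 1 \<Longrightarrow> FBDT (pow_F m) a c b = 2"
    and "t ^ (2 ^ m + 1) \<noteq> 1 \<Longrightarrow> T = 0 \<Longrightarrow> FBDT (pow_F m) a c b = 0"
    and "t \<noteq> 1 \<Longrightarrow> t ^ (2 ^ m + 1) = 1 \<Longrightarrow> FBDT (pow_F m) a c b = 0"
proof -
  note char = CHAR_eq_2[OF card]
  have "b / a \<in> {0, 1}"
    using a b by auto
  hence eq: "FBDT (pow_F m) a c b = card {x. pow_F m x + pow_F m (x + 1) = t}"
    using FBDT_pow_F_scale[OF char a] FBDT_1_trivial_shift[OF char] by (metis t_def)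
  have t1: "t \<noteq> 1" if "t ^ (2 ^ m + 1) \<noteq> 1"
    using that by auto
  note fibre = derivative_fibre_even[OF card m, of t, folded T_def]
  show "FBDT (pow_F m) a c b = 2" if "t ^ (2 ^ m + 1) \<noteq> 1" "T = 1"
    using fibre(3)[OF t1[OF that(1)] that] eq by auto
  show "FBDT (pow_F m) a c b = 0" if "t ^ (2 ^ m + 1) \<noteq> 1" "T = 0"
    using fibre(4)[OF t1[OF that(1)] that] eq by simp
  show "FBDT (pow_F m) a c b = 0" if "t \<noteq> 1" "t ^ (2 ^ m + 1) = 1"
    using fibre(2)[OF that] eq by simp
qed

lemma FBDT_even:
  fixes a b c :: "'a::finite_field"
  assumes m: "m > 0" and card: "CARD('a) = 2 ^ (2 * m)"
  shows "(a, c, b) \<in> even_I_2m_1 m \<union> even_I_2m_2 m \<Longrightarrow> FBDT (pow_F m) a c b = 2 ^ m" (is "?A1 \<Longrightarrow> _")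
    and "(a, c, b) \<in> even_I_2_1 m \<union> even_I_2_2 m \<Longrightarrow> FBDT (pow_F m) a c b = 2" (is "?A2 \<Longrightarrow> _")
    and "(a, c, b) \<in> even_I_0_2 m \<union> even_I_0_3 m \<union> even_I_0_4 m \<union> even_I_0_5 m \<union> even_I_0_6 m \<Longrightarrow>
      FBDT (pow_F m) a c b = 0" (is "?A3 \<Longrightarrow> _")
proof -
  note char = CHAR_eq_2[OF card]
  let ?K = "subfield_of_order (2 ^ m) :: 'a set"
  \<comment> \<open>The index sets speak of \<open>a / b\<close>, while scaling produces
    \<open>b / a\<close>; the fixed field is closed under inverses.\<close>
  have "inverse (a / b) ^ (2 ^ m) = inverse (a / b) \<longleftrightarrow> (a / b) ^ (2 ^ m) = a / b"
    by (simp only: power_inverse inverse_eq_iff_eq)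
  hence K01: "0 \<in> ?K" "1 \<in> ?K" and K_inv: "a / b \<in> ?K \<longleftrightarrow> b / a \<in> ?K"
    unfolding subfield_of_order_eq(1)[OF m card] by (simp_all add: power_0_left)
  show "FBDT (pow_F m) a c b = 2 ^ m" if ?A1
    using that FBDT_even_eq_1[OF m card, of a c b] K01 K_inv
    by (auto simp: even_I_2m_1_def even_I_2m_2_def)
  \<comment> \<open>For \<open>c = 0\<close> also \<open>t = 0\<close>, and the fraction under the
    trace is 1; its trace is the parity of \<open>m\<close>.\<close>
  have Tr_m_one: "Tr m (1 :: 'a) = (if odd m then 1 else 0)"
    using of_nat_CHAR[where ?'a = 'a] by (auto simp: Tr_one char elim!: evenE oddE)
  have t0: "t_of m a 0 = 0"
    by (simp add: t_of_def)
  note trivial = FBDT_even_trivial_shift[OF card m, of a b c]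
  show "FBDT (pow_F m) a c b = 2" if ?A2
    using that trivial(1) Tr_m_one by (auto simp: even_I_2_1_def even_I_2_2_def t0 power_0_left)
  show "FBDT (pow_F m) a c b = 0" if ?A3
    using that trivial(2,3) Tr_m_one FBDT_even_neq_1[OF m card, of a c b]
      FBDT_even_eq_1[OF m card, of a c b] K_inv
    unfolding even_I_0_2_def even_I_0_3_def even_I_0_4_def even_I_0_5_def even_I_0_6_def
    \<comment> \<open>The split serves \<open>even_I_0_6\<close>, which leaves \<open>t\<close>
      free: over 1 the quotient lies outside the subfield, and over other values no nontrivial shift
      survives.\<close>
    by (cases "t_of m a c = 1") (auto simp: t0 power_0_left)
qed

theorem theorem3:
  fixes m n :: nat
  assumes "m > 0" and "n \<in> {2 * m, 2 * m + 1}"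
    and "CARD('a::finite_field) = 2 ^ n"
  shows "(n = 2 * m + 1 \<longrightarrow>
           (\<forall>a c b :: 'a.
              ((a, c, b) \<in> I_full \<longrightarrow> FBDT (pow_F m) a c b = 2 ^ n) \<and>
              ((a, c, b) \<in> odd_I_2 m \<longrightarrow> FBDT (pow_F m) a c b = 2) \<and>
              ((a, c, b) \<in> odd_I_0_1 \<union> odd_I_0_2 m \<union> odd_I_0_3 \<longrightarrow>
                 FBDT (pow_F m) a c b = 0))) \<and>
         (n = 2 * m \<longrightarrow>
           (\<forall>a c b :: 'a.
              ((a, c, b) \<in> I_full \<longrightarrow> FBDT (pow_F m) a c b = 2 ^ n) \<and>
              ((a, c, b) \<in> even_I_2m_1 m \<union> even_I_2m_2 m \<longrightarrow> FBDT (pow_F m) a c b = 2 ^ m) \<and>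
              ((a, c, b) \<in> even_I_2_1 m \<union> even_I_2_2 m \<longrightarrow> FBDT (pow_F m) a c b = 2) \<and>
              ((a, c, b) \<in> even_I_0_1 \<union> even_I_0_2 m \<union> even_I_0_3 m \<union> even_I_0_4 m
                  \<union> even_I_0_5 m \<union> even_I_0_6 m \<longrightarrow>
                 FBDT (pow_F m) a c b = 0)))"
proof -
  have char: "CHAR('a) = 2"
    by (rule CHAR_eq_2[OF assms(3)])
  have zero: "FBDT (pow_F m) 0 c (b :: 'a) = (if c = 0 then 2 ^ n else 0)" for c b
    by (simp add: FBDT_zero_left[OF char] assms(3))
  show ?thesis
  proof (cases "n = 2 * m + 1")
    case True
    hence card: "CARD('a) = 2 ^ (2 * m + 1)"
      using assms(3) by simp
    show ?thesis
      using True FBDT_odd[OF card] by (auto simp: I_full_def odd_I_0_1_def zero)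
  next
    case False
    hence n: "n = 2 * m" and card: "CARD('a) = 2 ^ (2 * m)"
      using assms(2,3) by auto
    show ?thesis
      using n FBDT_even[OF assms(1) card] by (auto simp: I_full_def even_I_0_1_def zero)
  qed
qed

end
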